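(* Let $n\geq 2$ be an integer and let $G=C_{2n}(1,n)$. Then $G$ is levelable if and only if $n\in\{2,3,4\}$.
   Context: For $m\geq 2$ and $S\subseteq\{1,\ldots,\lfloor m/2\rfloor\}$, the circulant graph $C_m(S)$ is the graph on the vertex set $\{x_1,\ldots,x_m\}$ such that $\{x_i,x_j\}$ ($i\ne j$) is an edge precisely when $|i-j|\in S$ or $m-|i-j|\in S$. One writes $C_m(a,b)$ for $C_m(\{a,b\})$. A finite simple graph $G$ on $\{x_1,\ldots,x_m\}$ is levelable if there exist positive integers $c_1,\ldots,c_m$ and a constant $c$ such that $\sum_{x_i\in W}c_i=c$ for every maximal (under inclusion) independent set $W$ of $G$. *)

theory Defs
  imports Main
begin

text \<open>An undirected graph is a pair of a vertex set and a set of edges, each edge being a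
  two-element set of vertices.\<close>

type_synonym 'a graph = "'a set \<times> 'a set set"

definition finite_simple_graph :: "'a graph \<Rightarrow> bool" where
  "finite_simple_graph G \<longleftrightarrow>
     finite (fst G) \<and> (\<forall>e\<in>snd G. e \<subseteq> fst G \<and> card e = 2)"

definition independent_set :: "'a graph \<Rightarrow> 'a set \<Rightarrow> bool" where
  "independent_set G W \<longleftrightarrow> W \<subseteq> fst G \<and> (\<forall>u\<in>W. \<forall>v\<in>W. {u, v} \<notin> snd G)"

definition maximal_independent_set :: "'a graph \<Rightarrow> 'a set \<Rightarrow> bool" where
  "maximal_independent_set G W \<longleftrightarrow>
     independent_set G W \<and> (\<forall>W'. independent_set G W' \<and> W \<subseteq> W' \<longrightarrow> W' = W)"

definition levelable :: "'a graph \<Rightarrow> bool" where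
  "levelable G \<longleftrightarrow>
     finite_simple_graph G \<and>
     (\<exists>(w :: 'a \<Rightarrow> int) (c :: int).
        (\<forall>x\<in>fst G. w x > 0) \<and>
        (\<forall>W. maximal_independent_set G W \<longrightarrow> (\<Sum>x\<in>W. w x) = c))"

text \<open>The vertex \<open>x\<^sub>i\<close> is represented by its index \<open>i\<close>. Differences are taken in
  the integers; the intended parameters are \<open>m \<ge> 2\<close> and \<open>S \<subseteq> {1..m div 2}\<close>.\<close>

definition circulant_graph :: "nat \<Rightarrow> int set \<Rightarrow> nat graph" where
  "circulant_graph m S =
     ({1..m},
      {{i, j} | i j. i \<in> {1..m} \<and> j \<in> {1..m} \<and> i \<noteq> j \<and>
         (\<bar>int i - int j\<bar> \<in> S \<or> int m - \<bar>int i - int j\<bar> \<in> S)})"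

lemma finite_simple_graph_circulant_graph: "finite_simple_graph (circulant_graph m S)"
  by (auto simp: finite_simple_graph_def circulant_graph_def card_2_iff)

end

theory Submission
  imports Defs
begin

text \<open>For \<open>n \<ge> 5\<close> fix the two vertices \<open>n + 1\<close> and \<open>n + 5\<close> of an independent set: the only
  vertices among \<open>1, \<dots>, 5\<close> and \<open>n + 1, \<dots>, n + 5\<close> that are still free are \<open>2, 3, 4, n + 3\<close>. They
  span a star with centre \<open>3\<close> that is cut off from the rest of the graph, so the weight of \<open>3\<close> is
  the sum of the weights of \<open>2\<close>, \<open>4\<close> and \<open>n + 3\<close>. Fixing \<open>n + 1\<close> and \<open>n + 4\<close> instead isolates
  the edge \<open>{2, 3}\<close>, so \<open>2\<close> and \<open>3\<close> have equal weights. Both together contradict positivity.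
  For \<open>n = 2, 3, 4\<close> all maximal independent sets have the same size.\<close>

section \<open>Local exchange in maximal independent sets\<close>

text \<open>Without loops, a vertex with no neighbour in \<open>W\<close> can be adjoined to
  \<open>W\<close>. This trades the quantifier over supersets for a condition on each
  vertex.\<close>

lemma maximal_independent_set_iff:
  assumes "finite_simple_graph G"
  shows "maximal_independent_set G W \<longleftrightarrow>
    W \<subseteq> fst G \<and> (\<forall>v\<in>fst G. v \<in> W \<longleftrightarrow> (\<forall>u\<in>W. {u, v} \<notin> snd G))"
proof
  assume max: "maximal_independent_set G W"
  then have W: "W \<subseteq> fst G" and ind: "\<And>u v. u \<in> W \<Longrightarrow> v \<in> W \<Longrightarrow> {u, v} \<notin> snd G"
    by (auto simp: maximal_independent_set_def independent_set_def)
  have "v \<in> W" if v: "v \<in> fst G" "\<forall>u\<in>W. {u, v} \<notin> snd G" for v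
  proof -
    have "{v, v} \<notin> snd G"
      using assms by (auto simp: finite_simple_graph_def)
    then have "independent_set G (insert v W)"
      using W ind v by (auto simp: independent_set_def insert_commute)
    then have "insert v W = W"
      using max by (auto simp: maximal_independent_set_def)
    then show ?thesis by auto
  qed
  with W ind show "W \<subseteq> fst G \<and> (\<forall>v\<in>fst G. v \<in> W \<longleftrightarrow> (\<forall>u\<in>W. {u, v} \<notin> snd G))"
    by blast
next
  assume "W \<subseteq> fst G \<and> (\<forall>v\<in>fst G. v \<in> W \<longleftrightarrow> (\<forall>u\<in>W. {u, v} \<notin> snd G))"
  then show "maximal_independent_set G W"
    unfolding maximal_independent_set_def independent_set_def by blast
qed

lemma maximal_independent_superset:
  assumes "finite_simple_graph G" "independent_set G I"
  obtains M where "maximal_independent_set G M" "I \<subseteq> M"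
proof -
  let ?F = "{W. independent_set G W \<and> I \<subseteq> W}"
  have "?F \<subseteq> Pow (fst G)"
    by (auto simp: independent_set_def)
  moreover have "finite (fst G)"
    using assms(1) by (simp add: finite_simple_graph_def)
  ultimately have "finite ?F"
    by (meson finite_Pow_iff finite_subset)
  moreover have "I \<in> ?F"
    using assms(2) by simp
  ultimately obtain M where "M \<in> ?F" "\<forall>W\<in>?F. M \<subseteq> W \<longrightarrow> M = W"
    using finite_has_maximal[of ?F] by blast
  then have "maximal_independent_set G M" "I \<subseteq> M"
    by (auto simp: maximal_independent_set_def)
  then show ?thesis by (rule that)
qed

text \<open>Once \<open>I\<close> has been chosen, the vertices in \<open>U\<close> are free and separated from all other free
  vertices, so the choice made inside \<open>U\<close> can be exchanged without touching the rest.\<close>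

lemma weight_exchange:
  fixes w :: "'a \<Rightarrow> int"
  assumes G: "finite_simple_graph G"
    and level: "\<And>W. maximal_independent_set G W \<Longrightarrow> sum w W = c"
    and I: "independent_set G I"
    and U: "U \<subseteq> fst G"
    and disj: "I \<inter> U = {}"
    and free: "\<And>u i. u \<in> U \<Longrightarrow> i \<in> I \<Longrightarrow> {i, u} \<notin> snd G"
    and cut: "\<And>u v. u \<in> U \<Longrightarrow> {u, v} \<in> snd G \<Longrightarrow> v \<in> U \<or> (\<exists>i\<in>I. {i, v} \<in> snd G)"
    and S: "S \<subseteq> U" "\<And>v. v \<in> U \<Longrightarrow> v \<in> S \<longleftrightarrow> (\<forall>u\<in>S. {u, v} \<notin> snd G)"
    and T: "T \<subseteq> U" "\<And>v. v \<in> U \<Longrightarrow> v \<in> T \<longleftrightarrow> (\<forall>u\<in>T. {u, v} \<notin> snd G)"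
  shows "sum w S = sum w T"
proof -
  have "{i, s} \<notin> snd G" "{s, i} \<notin> snd G" if "i \<in> I" "s \<in> S" for i s
    using free that S(1) by (metis insert_commute subsetD)+
  moreover have "{s, t} \<notin> snd G" if "s \<in> S" "t \<in> S" for s t
    using S that by blast
  ultimately have "independent_set G (I \<union> S)"
    using I U S(1) unfolding independent_set_def by blast
  then obtain M where M: "maximal_independent_set G M" "I \<union> S \<subseteq> M"
    using maximal_independent_superset[OF G] by blast
  then have MV: "M \<subseteq> fst G" and Mv: "\<And>v. v \<in> fst G \<Longrightarrow> v \<in> M \<longleftrightarrow> (\<forall>u\<in>M. {u, v} \<notin> snd G)"
    using maximal_independent_set_iff[OF G] by blast+
  \<comment> \<open>A neighbour of \<open>u\<close> outside \<open>U\<close> is adjacent to some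
    \<open>i\<close> in \<open>I\<close> by \<open>cut\<close>. Since \<open>I\<close> lies in the
    independent set \<open>M\<close>, that neighbour is not in \<open>M\<close>.\<close>
  have sep: "{u, v} \<notin> snd G" if "u \<in> U" "v \<in> M - U" for u v
    using cut[OF that(1), of v] that Mv MV M(2) by blast
  have MU: "M \<inter> U = S"
    using S Mv M(2) U by blast
  have "maximal_independent_set G (M - U \<union> T)"
    unfolding maximal_independent_set_iff[OF G]
  proof (intro conjI ballI)
    show "M - U \<union> T \<subseteq> fst G"
      using MV T(1) U by blast
    fix v assume v: "v \<in> fst G"
    show "v \<in> M - U \<union> T \<longleftrightarrow> (\<forall>u\<in>M - U \<union> T. {u, v} \<notin> snd G)"
    proof (cases "v \<in> U")
      case True
      then have "\<forall>u\<in>M - U. {u, v} \<notin> snd G"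
        using sep by (metis insert_commute)
      with True T(2)[OF True] show ?thesis by blast
    next
      case False
      \<comment> \<open>If the known neighbour of \<open>v\<close> in \<open>M\<close> lies in
        \<open>U\<close> and may be lost in the exchange, \<open>cut\<close> supplies another one in
        \<open>I\<close>, which survives.\<close>
      have "v \<notin> M \<longleftrightarrow> (\<exists>u\<in>M - U. {u, v} \<in> snd G)"
      proof
        assume "v \<notin> M"
        then obtain u where u: "u \<in> M" "{u, v} \<in> snd G"
          using Mv v by blast
        show "\<exists>u\<in>M - U. {u, v} \<in> snd G"
        proof (cases "u \<in> U")
          case True
          then obtain i where "i \<in> I" "{i, v} \<in> snd G"
            using cut u \<open>v \<notin> U\<close> by blast
          with M(2) disj show ?thesis by blast
        qed (use u in blast)
      qed (use Mv v in blast)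
      moreover have "\<forall>u\<in>T. {u, v} \<notin> snd G" if "v \<in> M"
        using sep that False T(1) by blast
      ultimately show ?thesis
        using False T(1) by blast
    qed
  qed
  then have "sum w (M - U \<union> T) = sum w (M - U \<union> S)"
    using level M(1) MU by (metis Un_Diff_Int)
  moreover have "finite M" "finite U"
    using G MV U by (auto simp: finite_simple_graph_def finite_subset)
  then have "sum w (M - U \<union> X) = sum w (M - U) + sum w X" if "X \<subseteq> U" for X
    using that by (intro sum.union_disjoint) (auto intro: finite_subset)
  ultimately show ?thesis
    using S(1) T(1) by simp
qed

section \<open>Adjacency and the case of large n\<close>

text \<open>The graph is a Moebius ladder for \<open>n \<ge> 2\<close>: a cycle with its antipodes
  joined. The distance \<open>n\<close> is its own complement in \<open>2 * n\<close>, so only the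
  distance 1 yields wrap-around cases.\<close>

lemma edge_circulant_graph_1_n:
  assumes "n \<ge> 1"
  shows "{i, j} \<in> snd (circulant_graph (2 * n) {1, int n}) \<longleftrightarrow>
    i \<in> {1..2 * n} \<and> j \<in> {1..2 * n} \<and> i \<noteq> j \<and>
    (j = i + 1 \<or> i = j + 1 \<or> j = i + n \<or> i = j + n \<or> j + 1 = i + 2 * n \<or> i + 1 = j + 2 * n)"
    (is "_ \<longleftrightarrow> ?R")
proof -
  have "{i, j} \<in> snd (circulant_graph (2 * n) {1, int n}) \<longleftrightarrow>
      i \<in> {1..2 * n} \<and> j \<in> {1..2 * n} \<and> i \<noteq> j \<and>
      (\<bar>int i - int j\<bar> \<in> {1, int n} \<or> int (2 * n) - \<bar>int i - int j\<bar> \<in> {1, int n})"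
    unfolding circulant_graph_def by (auto simp: doubleton_eq_iff abs_minus_commute)
  also have "\<dots> \<longleftrightarrow> ?R"
    using assms by auto
  finally show ?thesis .
qed

lemma not_levelable_circulant_graph_1_n:
  assumes n: "n \<ge> 5"
  shows "\<not> levelable (circulant_graph (2 * n) {1, int n})"
proof
  let ?G = "circulant_graph (2 * n) {1, int n}"
  assume "levelable ?G"
  then obtain w :: "nat \<Rightarrow> int" and c where pos: "\<And>x. x \<in> fst ?G \<Longrightarrow> w x > 0"
    and level: "\<And>W. maximal_independent_set ?G W \<Longrightarrow> sum w W = c"
    unfolding levelable_def by blast
  have V: "fst ?G = {1..2 * n}"
    by (simp add: circulant_graph_def)
  have n1: "n \<ge> 1"
    using n by simp
  \<comment> \<open>For \<open>n = 5\<close> the vertex \<open>n + 5\<close> is the last one, so its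
    successor wraps around to 1.\<close>
  have row: "{2, v} \<in> snd ?G \<longleftrightarrow> v \<in> {1, 3, n + 2}"
    "{3, v} \<in> snd ?G \<longleftrightarrow> v \<in> {2, 4, n + 3}"
    "{4, v} \<in> snd ?G \<longleftrightarrow> v \<in> {3, 5, n + 4}"
    "{n + 1, v} \<in> snd ?G \<longleftrightarrow> v \<in> {1, n, n + 2}"
    "{n + 3, v} \<in> snd ?G \<longleftrightarrow> v \<in> {3, n + 2, n + 4}"
    "{n + 4, v} \<in> snd ?G \<longleftrightarrow> v \<in> {4, n + 3, n + 5}"
    "{n + 5, v} \<in> snd ?G \<longleftrightarrow> v \<in> {5, n + 4, if n = 5 then 1 else n + 6}" for v
    unfolding edge_circulant_graph_1_n[OF n1] using n by auto
  \<comment> \<open>The neighbours of the star outside it are \<open>1\<close> and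
    \<open>n + 2\<close>, adjacent to \<open>n + 1\<close>, and \<open>5\<close> and
    \<open>n + 4\<close>, adjacent to \<open>n + 5\<close>.\<close>
  have "sum w {3} = sum w {2, 4, n + 3}"
  proof (rule weight_exchange[where U = "{2, 3, 4, n + 3}" and I = "{n + 1, n + 5}",
        OF finite_simple_graph_circulant_graph level])
    show "independent_set ?G {n + 1, n + 5}"
      unfolding independent_set_def ball_simps row V using n by simp
    show "{i, u} \<notin> snd ?G" if "u \<in> {2, 3, 4, n + 3}" "i \<in> {n + 1, n + 5}" for u i
      using that n row by (auto split: if_splits)
    show "v \<in> {2, 3, 4, n + 3} \<or> (\<exists>i\<in>{n + 1, n + 5}. {i, v} \<in> snd ?G)"
      if "u \<in> {2, 3, 4, n + 3}" "{u, v} \<in> snd ?G" for u v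
    proof -
      have "v \<in> {1, 2, 3, 4, 5, n + 2, n + 3, n + 4}"
        using that by (auto simp: row)
      then show ?thesis
        unfolding bex_simps row by auto
    qed
    show "v \<in> {3} \<longleftrightarrow> (\<forall>u\<in>{3}. {u, v} \<notin> snd ?G)" if "v \<in> {2, 3, 4, n + 3}" for v
      using that n unfolding ball_simps row by auto
    show "v \<in> {2, 4, n + 3} \<longleftrightarrow> (\<forall>u\<in>{2, 4, n + 3}. {u, v} \<notin> snd ?G)"
      if "v \<in> {2, 3, 4, n + 3}" for v
      using that n unfolding ball_simps row by auto
  qed (use n in \<open>auto simp: V\<close>)
  \<comment> \<open>Here \<open>n + 1\<close> again excludes \<open>1\<close> and
    \<open>n + 2\<close>, while \<open>n + 4\<close> excludes \<open>4\<close> and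
    \<open>n + 3\<close>.\<close>
  moreover have "sum w {2} = sum w {3}"
  proof (rule weight_exchange[where U = "{2, 3}" and I = "{n + 1, n + 4}",
        OF finite_simple_graph_circulant_graph level])
    show "independent_set ?G {n + 1, n + 4}"
      unfolding independent_set_def ball_simps row V using n by simp
    show "{i, u} \<notin> snd ?G" if "u \<in> {2, 3}" "i \<in> {n + 1, n + 4}" for u i
      using that n row by auto
    show "v \<in> {2, 3} \<or> (\<exists>i\<in>{n + 1, n + 4}. {i, v} \<in> snd ?G)"
      if "u \<in> {2, 3}" "{u, v} \<in> snd ?G" for u v
    proof -
      have "v \<in> {1, 2, 3, 4, n + 2, n + 3}"
        using that by (auto simp: row)
      then show ?thesis
        unfolding bex_simps row by auto
    qed
    show "v \<in> {2} \<longleftrightarrow> (\<forall>u\<in>{2}. {u, v} \<notin> snd ?G)" if "v \<in> {2, 3}" for v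
      using that n unfolding ball_simps row by auto
    show "v \<in> {3} \<longleftrightarrow> (\<forall>u\<in>{3}. {u, v} \<notin> snd ?G)" if "v \<in> {2, 3}" for v
      using that n unfolding ball_simps row by auto
  qed (use n in \<open>auto simp: V\<close>)
  moreover have "w 4 > 0" "w (n + 3) > 0"
    using n by (auto intro!: pos simp: V)
  \<comment> \<open>The two equations leave \<open>w 4 + w (n + 3) = 0\<close>.\<close>
  ultimately show False
    using n by simp
qed

section \<open>The cases n = 2, 3, 4\<close>

lemma levelable_if_equicardinal:
  assumes "finite_simple_graph G"
    and "\<And>W. maximal_independent_set G W \<Longrightarrow> card W = k"
  shows "levelable G"
  unfolding levelable_def
  using assms by (intro conjI exI[of _ "\<lambda>_. 1"] exI[of _ "int k"]) auto

text \<open>The graphs are K_4, K_{3,3} and the Wagner graph; their maximal independent sets have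
  sizes 1, 3 and 3.\<close>

lemma levelable_circulant_graph_1_n:
  assumes "n \<in> {2, 3, 4}"
  shows "levelable (circulant_graph (2 * n) {1, int n})"
proof (rule levelable_if_equicardinal[OF finite_simple_graph_circulant_graph])
  let ?G = "circulant_graph (2 * n) {1, int n}"
  fix W assume "maximal_independent_set ?G W"
  moreover have "fst ?G = {1..2 * n}"
    by (simp add: circulant_graph_def)
  ultimately have W: "W \<subseteq> {1..2 * n}"
    and mis: "\<And>v. v \<in> {1..2 * n} \<Longrightarrow> v \<in> W \<longleftrightarrow> (\<forall>u\<in>W. {u, v} \<notin> snd ?G)"
    unfolding maximal_independent_set_iff[OF finite_simple_graph_circulant_graph] by blast+
  \<comment> \<open>Ranging over all vertices instead of \<open>W\<close> makes maximality a finite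
    propositional condition on the memberships.\<close>
  have iff: "v \<in> W \<longleftrightarrow> (\<forall>u\<in>{1..2 * n}. {u, v} \<in> snd ?G \<longrightarrow> u \<notin> W)" if "v \<in> {1..2 * n}" for v
    using W mis[OF that] by blast
  have card: "card W = (\<Sum>v\<in>{1..2 * n}. of_bool (v \<in> W))"
    using W by (simp add: Int_absorb1 Int_absorb2)
  have interval: "{Suc 0..4} = {1, 2, 3, 4}" "{Suc 0..6} = {1, 2, 3, 4, 5, 6}"
    "{Suc 0..8} = {1, 2, 3, 4, 5, 6, 7, 8}"
    by auto
  consider "n = 2" | "n = 3" | "n = 4"
    using assms by auto
  then show "card W = (if n = 2 then 1 else 3)"
  proof cases
    case 1
    have "1 \<in> W \<longleftrightarrow> 2 \<notin> W \<and> 3 \<notin> W \<and> 4 \<notin> W" "2 \<in> W \<longleftrightarrow> 1 \<notin> W \<and> 3 \<notin> W \<and> 4 \<notin> W"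
      "3 \<in> W \<longleftrightarrow> 1 \<notin> W \<and> 2 \<notin> W \<and> 4 \<notin> W" "4 \<in> W \<longleftrightarrow> 1 \<notin> W \<and> 2 \<notin> W \<and> 3 \<notin> W"
      by (subst iff, force simp: 1, simp add: 1 edge_circulant_graph_1_n[of 2, simplified] interval)+
    moreover have "card W = of_bool (1 \<in> W) + of_bool (2 \<in> W) + of_bool (3 \<in> W) + of_bool (4 \<in> W)"
      using card by (simp add: 1 interval)
    ultimately have "card W = 1"
      unfolding of_bool_def by fastforce
    then show ?thesis
      by (simp add: 1)
  next
    case 2
    have nbr: "1 \<in> W \<longleftrightarrow> 2 \<notin> W \<and> 4 \<notin> W \<and> 6 \<notin> W" "2 \<in> W \<longleftrightarrow> 1 \<notin> W \<and> 3 \<notin> W \<and> 5 \<notin> W"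
      "3 \<in> W \<longleftrightarrow> 2 \<notin> W \<and> 4 \<notin> W \<and> 6 \<notin> W" "4 \<in> W \<longleftrightarrow> 1 \<notin> W \<and> 3 \<notin> W \<and> 5 \<notin> W"
      "5 \<in> W \<longleftrightarrow> 2 \<notin> W \<and> 4 \<notin> W \<and> 6 \<notin> W" "6 \<in> W \<longleftrightarrow> 1 \<notin> W \<and> 3 \<notin> W \<and> 5 \<notin> W"
      by (subst iff, force simp: 2, simp add: 2 edge_circulant_graph_1_n[of 3, simplified] interval)+
    have "card W = of_bool (1 \<in> W) + of_bool (2 \<in> W) + of_bool (3 \<in> W) + of_bool (4 \<in> W) +
      of_bool (5 \<in> W) + of_bool (6 \<in> W)"
      using card by (simp add: 2 interval)
    \<comment> \<open>The odd and the even vertices are the two sides of K_{3,3}, and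
      \<open>W\<close> is exactly one side.\<close>
    moreover have "3 \<in> W \<longleftrightarrow> 1 \<in> W" "5 \<in> W \<longleftrightarrow> 1 \<in> W"
      "2 \<in> W \<longleftrightarrow> 1 \<notin> W" "4 \<in> W \<longleftrightarrow> 1 \<notin> W" "6 \<in> W \<longleftrightarrow> 1 \<notin> W"
      using nbr by blast+
    ultimately show ?thesis
      by (cases "1 \<in> W") (simp_all add: 2)
  next
    case 3
    have nbr: "1 \<in> W \<longleftrightarrow> 2 \<notin> W \<and> 5 \<notin> W \<and> 8 \<notin> W" "2 \<in> W \<longleftrightarrow> 1 \<notin> W \<and> 3 \<notin> W \<and> 6 \<notin> W"
      "3 \<in> W \<longleftrightarrow> 2 \<notin> W \<and> 4 \<notin> W \<and> 7 \<notin> W" "4 \<in> W \<longleftrightarrow> 3 \<notin> W \<and> 5 \<notin> W \<and> 8 \<notin> W"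
      "5 \<in> W \<longleftrightarrow> 1 \<notin> W \<and> 4 \<notin> W \<and> 6 \<notin> W" "6 \<in> W \<longleftrightarrow> 2 \<notin> W \<and> 5 \<notin> W \<and> 7 \<notin> W"
      "7 \<in> W \<longleftrightarrow> 3 \<notin> W \<and> 6 \<notin> W \<and> 8 \<notin> W" "8 \<in> W \<longleftrightarrow> 1 \<notin> W \<and> 4 \<notin> W \<and> 7 \<notin> W"
      by (subst iff, force simp: 3, simp add: 3 edge_circulant_graph_1_n[of 4, simplified] interval)+
    have "card W = of_bool (1 \<in> W) + of_bool (2 \<in> W) + of_bool (3 \<in> W) + of_bool (4 \<in> W) +
      of_bool (5 \<in> W) + of_bool (6 \<in> W) + of_bool (7 \<in> W) + of_bool (8 \<in> W)"
      using card by (simp add: 3 interval)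
    text \<open>As rewrite rules the equivalences would loop, unlike the following disjunctions.\<close>
    moreover have "1 \<notin> W \<or> 2 \<notin> W" "1 \<notin> W \<or> 5 \<notin> W" "1 \<notin> W \<or> 8 \<notin> W"
      "2 \<notin> W \<or> 3 \<notin> W" "2 \<notin> W \<or> 6 \<notin> W" "3 \<notin> W \<or> 4 \<notin> W"
      "3 \<notin> W \<or> 7 \<notin> W" "4 \<notin> W \<or> 5 \<notin> W" "4 \<notin> W \<or> 8 \<notin> W"
      "5 \<notin> W \<or> 6 \<notin> W" "6 \<notin> W \<or> 7 \<notin> W" "7 \<notin> W \<or> 8 \<notin> W"
      "1 \<in> W \<or> 2 \<in> W \<or> 5 \<in> W \<or> 8 \<in> W" "2 \<in> W \<or> 1 \<in> W \<or> 3 \<in> W \<or> 6 \<in> W"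
      "3 \<in> W \<or> 2 \<in> W \<or> 4 \<in> W \<or> 7 \<in> W" "4 \<in> W \<or> 3 \<in> W \<or> 5 \<in> W \<or> 8 \<in> W"
      "5 \<in> W \<or> 1 \<in> W \<or> 4 \<in> W \<or> 6 \<in> W" "6 \<in> W \<or> 2 \<in> W \<or> 5 \<in> W \<or> 7 \<in> W"
      "7 \<in> W \<or> 3 \<in> W \<or> 6 \<in> W \<or> 8 \<in> W" "8 \<in> W \<or> 1 \<in> W \<or> 4 \<in> W \<or> 7 \<in> W"
      using nbr by blast+
    ultimately show ?thesis
      \<comment> \<open>Fixing the odd members either gives a contradiction or determines the even
        ones, with three members in total.\<close>
      by (cases "1 \<in> W"; cases "3 \<in> W"; cases "5 \<in> W"; cases "7 \<in> W"; auto simp: 3)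
  qed
qed

theorem theorem6p4:
  fixes n :: nat
  assumes "n \<ge> 2"
  shows "levelable (circulant_graph (2 * n) {1, int n}) \<longleftrightarrow> n \<in> {2, 3, 4}"
proof (cases "n \<ge> 5")
  case True
  then show ?thesis
    using not_levelable_circulant_graph_1_n by auto
next
  case False
  with assms have "n \<in> {2, 3, 4}"
    by auto
  then show ?thesis
    using levelable_circulant_graph_1_n by blast
qed

end
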